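(* Let $C_n$ ($n\ge 3$) be the cycle graph on $n$ vertices. For every integer $r$ with $1\le r\le\lfloor n/2\rfloor$ (so $n\ge 2r$), $$\nu\Big(\tfrac1r,C_n\Big)=2\Big\lfloor\frac{n}{2r}\Big\rfloor,$$ and there exists an eigenvector $\vec\phi$ of the $1$-Laplacian of $C_n$ with eigenvalue $\frac1r$ such that $S(\vec\phi)=\nu(\frac1r,C_n)$.
   Context: For a finite simple connected graph $G=(V,E)$, $V=\{1,\dots,n\}$, with degrees $d_i$: $\mathrm{Sgn}(t)=\{1\}$ if $t>0$, $\{-1\}$ if $t<0$, $[-1,1]$ if $t=0$. A nonzero $\vec x\in\mathbb R^n$ is an eigenvector of the $1$-Laplacian with eigenvalue $\mu$ if there exist $z_{ij}\in\mathrm{Sgn}(x_i-x_j)$ with $z_{ji}=-z_{ij}$ (for all adjacent $i,j$) such that $\sum_{j\sim i}z_{ij}\in\mu d_i\,\mathrm{Sgn}(x_i)$ for all $i\in V$. The (strong) nodal domains of $\vec x$ are the vertex sets of the connected components of the subgraphs induced on $\{i:x_i>0\}$ and on $\{i:x_i<0\}$; $S(\vec x)$ is the total number of them. For an eigenvalue $\mu$ of $G$, $\nu(\mu,G)$ is the maximum of $S(\vec\phi)$ over all eigenvectors $\vec\phi$ of $G$ with eigenvalue $\mu$. *)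

theory Defs
  imports Complex_Main "Graph_Theory.Graph_Theory"
begin

text \<open>
  A finite simple graph is modelled, as in Graph_Theory, by a symmetric loopless relation
  on a finite vertex set (locale \<open>pair_graph\<close>); the degree of a vertex is its out-degree.
  A vector indexed by the vertices is a function to the reals of which only the values on
  the vertex set matter.
\<close>

definition Sgn :: "real \<Rightarrow> real set" where
  "Sgn t = (if t > 0 then {1} else if t < 0 then {-1} else {-1..1})"

definition one_laplacian_eigenvector ::
    "'a pair_pre_digraph \<Rightarrow> real \<Rightarrow> ('a \<Rightarrow> real) \<Rightarrow> bool" where
  "one_laplacian_eigenvector G \<mu> x \<longleftrightarrow>
     (\<exists>i\<in>pverts G. x i \<noteq> 0) \<and>
     (\<exists>z :: 'a \<Rightarrow> 'a \<Rightarrow> real.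
        (\<forall>(i, j)\<in>parcs G. z i j \<in> Sgn (x i - x j) \<and> z j i = - z i j) \<and>
        (\<forall>i\<in>pverts G. (\<Sum>j | (i, j) \<in> parcs G. z i j)
            \<in> (\<lambda>s. \<mu> * real (out_degree (with_proj G) i) * s) ` Sgn (x i)))"

text \<open>
  On a symmetric digraph the strongly connected components are the connected components of
  the underlying undirected graph, so \<open>sccs_verts\<close> is the set of their vertex sets.
\<close>

definition positive_nodal_domains :: "'a pair_pre_digraph \<Rightarrow> ('a \<Rightarrow> real) \<Rightarrow> 'a set set" where
  "positive_nodal_domains G x =
     pre_digraph.sccs_verts (with_proj G \<restriction> {i \<in> pverts G. x i > 0})"

definition negative_nodal_domains :: "'a pair_pre_digraph \<Rightarrow> ('a \<Rightarrow> real) \<Rightarrow> 'a set set" where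
  "negative_nodal_domains G x =
     pre_digraph.sccs_verts (with_proj G \<restriction> {i \<in> pverts G. x i < 0})"

definition nodal_count :: "'a pair_pre_digraph \<Rightarrow> ('a \<Rightarrow> real) \<Rightarrow> nat" where
  "nodal_count G x = card (positive_nodal_domains G x \<union> negative_nodal_domains G x)"

text \<open>
  \<open>Max\<close> is unspecified on the empty set, so \<open>max_nodal_count G \<mu>\<close> is meaningful only for
  an eigenvalue \<open>\<mu>\<close>.
\<close>

definition max_nodal_count :: "real \<Rightarrow> 'a pair_pre_digraph \<Rightarrow> nat" where
  "max_nodal_count \<mu> G = Max {nodal_count G \<phi> | \<phi>. one_laplacian_eigenvector G \<mu> \<phi>}"

text \<open>For \<open>i \<in> {1..n}\<close>, the cyclic successor of \<open>i\<close> is \<open>i mod n + 1\<close>.\<close>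

definition cycle_graph :: "nat \<Rightarrow> nat pair_pre_digraph" where
  "cycle_graph n =
     \<lparr> pverts = {1..n},
       parcs = {(i, j). i \<in> {1..n} \<and> j \<in> {1..n} \<and> (j = i mod n + 1 \<or> i = j mod n + 1)} \<rparr>"

lemma pair_graph_cycle_graph:
  assumes "n \<ge> 3"
  shows "pair_graph (cycle_graph n)"
proof
  show "finite (parcs (cycle_graph n))"
    by (rule finite_subset[of _ "{1..n} \<times> {1..n}"]) (auto simp: cycle_graph_def)
  show "symmetric (with_proj (cycle_graph n))"
    by (auto simp: symmetric_def cycle_graph_def sym_def)
  have *: "i mod n + 1 \<noteq> i" if "i \<in> {1..n}" for i
    using that assms by (cases "i = n") auto
  have "i \<noteq> j" if "(i, j) \<in> parcs (cycle_graph n)" for i j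
  proof -
    from that have "i \<in> {1..n}" "j \<in> {1..n}" "j = i mod n + 1 \<or> i = j mod n + 1"
      unfolding cycle_graph_def pair_pre_digraph.simps mem_Collect_eq case_prod_conv by blast+
    with * show ?thesis by metis
  qed
  then show "fst e \<noteq> snd e" if "e \<in> parcs (cycle_graph n)" for e
    using that by (cases e) simp
qed (auto simp: cycle_graph_def)

lemma connected_cycle_graph:
  assumes "n \<ge> 3"
  shows "connected (with_proj (cycle_graph n))"
proof -
  let ?G = "with_proj (cycle_graph n)"
  interpret G: graph ?G
    using assms by (intro pair_graph.pair_graphD_graph pair_graph_cycle_graph)
  have verts: "verts ?G = {1..n}"
    by (simp add: cycle_graph_def)
  have from_1: "1 \<rightarrow>\<^sup>*\<^bsub>?G\<^esub> Suc k" if "k < n" for k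
    using that
  proof (induction k)
    case 0
    then show ?case using G.reachable_refl[of 1] verts by simp
  next
    case (Suc k)
    have "Suc k \<rightarrow>\<^bsub>?G\<^esub> Suc (Suc k)"
      using Suc.prems by (simp add: cycle_graph_def)
    with Suc.IH Suc.prems show ?case
      using G.reachable_adj_trans by simp
  qed
  have reach: "u \<rightarrow>\<^sup>*\<^bsub>?G\<^esub> v" if "u \<in> {1..n}" "v \<in> {1..n}" for u v
  proof -
    have u: "1 \<rightarrow>\<^sup>*\<^bsub>?G\<^esub> u" and v: "1 \<rightarrow>\<^sup>*\<^bsub>?G\<^esub> v"
      using from_1[of "u - 1"] from_1[of "v - 1"] that by (cases u; cases v; simp)+
    show ?thesis
      using symmetric_reachable[OF G.sym_arcs u] v by (rule G.reachable_trans)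
  qed
  have "{1..n} \<noteq> {}"
    using assms by simp
  then show ?thesis
    using reach G.reachable_mk_symmetric_eq[OF G.sym_arcs] verts
    by (intro G.connectedI) metis+
qed

end

theory Submission
  imports Defs
begin

text \<open>
  Summing the eigenvalue equation over a positive nodal domain \<open>D\<close>, the antisymmetric \<open>z\<close>
  cancels inside \<open>D\<close> and equals \<open>1\<close> on every arc leaving \<open>D\<close>, so \<open>\<mu> * vol D\<close> is the number of
  boundary arcs of \<open>D\<close>, which is at least \<open>2\<close> in a cycle. Summing over all vertices shows that the
  positive vertices carry at most half of the total volume \<open>2 * n\<close>. Hence for \<open>\<mu> = 1 / r\<close> there
  are at most \<open>n div (2 * r)\<close> positive nodal domains, and by symmetry as many negative ones.
  Bounding the two signs separately gives the even number \<open>2 * (n div (2 * r))\<close> without looking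
  at the cyclic order of the domains. It is attained by alternating blocks of length \<open>r\<close>, where \<open>z\<close>
  runs linearly between \<open>-1\<close> and \<open>1\<close> on each block.
\<close>

section \<open>Boundaries of nodal domains\<close>

text \<open>Only outgoing arcs are collected, so in a symmetric graph each edge of the cut is
  counted once.\<close>

definition edge_boundary :: "'a pair_pre_digraph \<Rightarrow> 'a set \<Rightarrow> ('a \<times> 'a) set" where
  "edge_boundary G D = {(i, j) \<in> parcs G. i \<in> D \<and> j \<notin> D}"

text \<open>Choosing a preimage at each vertex turns the membership into an equality that can be
  summed over vertices.\<close>

lemma one_laplacian_eigenvectorE:
  assumes "one_laplacian_eigenvector G \<mu> x"
  obtains z s where
    "\<forall>(i, j)\<in>parcs G. z i j \<in> Sgn (x i - x j) \<and> z j i = - z i j"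
    "\<forall>i\<in>pverts G. s i \<in> Sgn (x i) \<and>
       (\<Sum>j | (i, j) \<in> parcs G. z i j) = \<mu> * real (out_degree (with_proj G) i) * s i"
proof -
  from assms obtain z where
    z: "\<forall>(i, j)\<in>parcs G. z i j \<in> Sgn (x i - x j) \<and> z j i = - z i j" and
    img: "\<forall>i\<in>pverts G. (\<Sum>j | (i, j) \<in> parcs G. z i j)
       \<in> (\<lambda>s. \<mu> * real (out_degree (with_proj G) i) * s) ` Sgn (x i)"
    unfolding one_laplacian_eigenvector_def by (elim conjE exE)
  from img have "\<forall>i\<in>pverts G. \<exists>s. s \<in> Sgn (x i) \<and>
       (\<Sum>j | (i, j) \<in> parcs G. z i j) = \<mu> * real (out_degree (with_proj G) i) * s"
    by (simp add: image_iff Bex_def)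
  then obtain s where "\<forall>i\<in>pverts G. s i \<in> Sgn (x i) \<and>
       (\<Sum>j | (i, j) \<in> parcs G. z i j) = \<mu> * real (out_degree (with_proj G) i) * s i"
    unfolding bchoice_iff ..
  with z show ?thesis by (rule that)
qed

lemma Sgn_uminus: "Sgn (- t) = uminus ` Sgn t"
  by (auto simp: Sgn_def)

text \<open>Negating \<open>x\<close>, \<open>z\<close> and the selection \<open>s\<close> together
  preserves every condition. This carries bounds on positive domains over to negative ones.\<close>

lemma one_laplacian_eigenvector_uminus:
  assumes "one_laplacian_eigenvector G \<mu> x"
  shows "one_laplacian_eigenvector G \<mu> (\<lambda>i. - x i)"
proof -
  obtain z s where
    "\<forall>(i, j)\<in>parcs G. z i j \<in> Sgn (x i - x j) \<and> z j i = - z i j"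
    "\<forall>i\<in>pverts G. s i \<in> Sgn (x i) \<and>
       (\<Sum>j | (i, j) \<in> parcs G. z i j) = \<mu> * real (out_degree (with_proj G) i) * s i"
    by (rule one_laplacian_eigenvectorE[OF assms])
  then have z: "\<And>i j. (i, j) \<in> parcs G \<Longrightarrow> z i j \<in> Sgn (x i - x j)"
    "\<And>i j. (i, j) \<in> parcs G \<Longrightarrow> z j i = - z i j"
    and s: "\<And>i. i \<in> pverts G \<Longrightarrow> s i \<in> Sgn (x i)"
    "\<And>i. i \<in> pverts G \<Longrightarrow>
       (\<Sum>j | (i, j) \<in> parcs G. z i j) = \<mu> * real (out_degree (with_proj G) i) * s i"
    by blast+
  have "- z i j \<in> Sgn (- x i - - x j)" if "(i, j) \<in> parcs G" for i j
    using z(1)[OF that] Sgn_uminus[of "x i - x j"] by auto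
  moreover have "(\<Sum>j | (i, j) \<in> parcs G. - z i j)
      \<in> (\<lambda>s. \<mu> * real (out_degree (with_proj G) i) * s) ` Sgn (- x i)" if "i \<in> pverts G" for i
    by (rule image_eqI[of _ _ "- s i"]) (use s[OF that] in \<open>auto simp: sum_negf Sgn_uminus\<close>)
  ultimately show ?thesis
    using assms z(2) unfolding one_laplacian_eigenvector_def
    by (intro conjI exI[of _ "\<lambda>i j. - z i j"]) auto
qed

lemma negative_nodal_domains_eq:
  "negative_nodal_domains G x = positive_nodal_domains G (\<lambda>i. - x i)"
  by (simp add: negative_nodal_domains_def positive_nodal_domains_def)

text \<open>A discrete divergence theorem: arcs inside \<open>D\<close> come in opposite pairs whose
  contributions cancel.\<close>

lemma (in pair_graph) sum_z_eq_edge_boundary: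
  fixes z :: "'a \<Rightarrow> 'a \<Rightarrow> real"
  assumes "D \<subseteq> pverts G" and anti: "\<And>i j. (i, j) \<in> parcs G \<Longrightarrow> z j i = - z i j"
  shows "(\<Sum>i\<in>D. \<Sum>j | (i, j) \<in> parcs G. z i j) = (\<Sum>(i, j)\<in>edge_boundary G D. z i j)"
proof -
  define I where "I = {(i, j) \<in> parcs G. i \<in> D \<and> j \<in> D}"
  have fin: "finite D" "finite I" "finite (edge_boundary G D)"
    using finite_subset[OF assms(1) pair_finite_verts]
      finite_subset[of I, OF _ pair_finite_arcs]
      finite_subset[of "edge_boundary G D", OF _ pair_finite_arcs]
    by (auto simp: I_def edge_boundary_def)
  have finj: "finite {j. (i, j) \<in> parcs G}" for i
    by (rule finite_subset[OF _ pair_finite_verts]) (auto dest: in_arcsD2)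
  have sym: "(j, i) \<in> parcs G" if "(i, j) \<in> parcs G" for i j
    using symD[OF pair_sym_arcs[unfolded symmetric_def]] that by simp
  have "(\<Sum>i\<in>D. \<Sum>j | (i, j) \<in> parcs G. z i j)
      = (\<Sum>(i, j)\<in>(SIGMA i:D. {j. (i, j) \<in> parcs G}). z i j)"
    using fin finj by (subst sum.Sigma) auto
  also have "(SIGMA i:D. {j. (i, j) \<in> parcs G}) = I \<union> edge_boundary G D"
    by (auto simp: I_def edge_boundary_def)
  also have "(\<Sum>(i, j)\<in>\<dots>. z i j) = (\<Sum>(i, j)\<in>I. z i j) + (\<Sum>(i, j)\<in>edge_boundary G D. z i j)"
    using fin by (intro sum.union_disjoint) (auto simp: I_def edge_boundary_def)
  \<comment> \<open>Reversal of arcs is a bijection of \<open>I\<close>, so the interior sum equals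
    its own negative.\<close>
  also have "(\<Sum>(i, j)\<in>I. z i j) = (\<Sum>(i, j)\<in>I. - z i j)"
  proof (rule sum.reindex_bij_witness[of _ prod.swap prod.swap])
    have "- z j i = z i j" if "(i, j) \<in> parcs G" for i j
      using anti[OF that] by linarith
    then show "(case prod.swap a of (i, j) \<Rightarrow> - z i j) = (case a of (i, j) \<Rightarrow> z i j)" if "a \<in> I" for a
      using that by (auto simp: I_def)
  qed (auto simp: I_def sym)
  then have "(\<Sum>(i, j)\<in>I. z i j) = 0"
    by (simp add: case_prod_unfold sum_negf)
  finally show ?thesis by simp
qed

section \<open>Nodal domains as components of the positive part\<close>

lemma (in pair_graph) positive_nodal_domains_conv:
  "positive_nodal_domains G x =
     pre_digraph.scc_of (with_proj G \<restriction> {i \<in> pverts G. x i > 0}) ` {i \<in> pverts G. x i > 0}"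
proof -
  interpret H: wf_digraph "with_proj G \<restriction> {i \<in> pverts G. x i > 0}"
    by (rule wellformed_induce_subgraph)
  show ?thesis
    unfolding positive_nodal_domains_def H.sccs_verts_conv_scc_of by simp
qed

lemma (in pair_graph) positive_nodal_domain_subset:
  assumes "D \<in> positive_nodal_domains G x"
  shows "D \<noteq> {}" "D \<subseteq> {i \<in> pverts G. x i > 0}"
proof -
  interpret H: wf_digraph "with_proj G \<restriction> {i \<in> pverts G. x i > 0}"
    by (rule wellformed_induce_subgraph)
  show "D \<subseteq> {i \<in> pverts G. x i > 0}"
    using assms H.sccs_verts_subsets[of D] by (simp add: positive_nodal_domains_def)
  show "D \<noteq> {}"
    using assms by (simp add: positive_nodal_domains_def H.in_sccs_verts_conv_reachable)
qed

lemma (in pair_graph) positive_nodal_domains_disjoint: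
  assumes "D \<in> positive_nodal_domains G x" "E \<in> positive_nodal_domains G x" "D \<noteq> E"
  shows "D \<inter> E = {}"
proof -
  interpret H: wf_digraph "with_proj G \<restriction> {i \<in> pverts G. x i > 0}"
    by (rule wellformed_induce_subgraph)
  show ?thesis
    using assms H.sccs_verts_disjoint unfolding positive_nodal_domains_def by blast
qed

text \<open>Symmetry puts both arcs between \<open>i\<close> and \<open>j\<close> into the induced
  subgraph, so they share a component. Hence every arc leaving a domain ends where \<open>x\<close>
  is not positive.\<close>

lemma (in pair_graph) positive_nodal_domain_closed:
  assumes D: "D \<in> positive_nodal_domains G x" and i: "i \<in> D"
    and ij: "(i, j) \<in> parcs G" and j: "x j > 0"
  shows "j \<in> D"
proof -
  let ?H = "with_proj G \<restriction> {i \<in> pverts G. x i > 0}"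
  interpret H: wf_digraph ?H
    by (rule wellformed_induce_subgraph)
  have "(j, i) \<in> parcs G"
    using symD[OF pair_sym_arcs[unfolded symmetric_def]] ij by simp
  moreover have "x i > 0" "i \<in> pverts G" "j \<in> pverts G"
    using positive_nodal_domain_subset[OF D] i in_arcsD2[OF ij] by auto
  ultimately have "i \<rightarrow>\<^bsub>?H\<^esub> j" "j \<rightarrow>\<^bsub>?H\<^esub> i"
    using ij j by (auto simp: arcs_ends_conv image_iff Bex_def)
  then have "i \<rightarrow>\<^sup>*\<^bsub>?H\<^esub> j" "j \<rightarrow>\<^sup>*\<^bsub>?H\<^esub> i"
    by auto
  then show ?thesis
    using D i by (auto simp: positive_nodal_domains_def H.in_sccs_verts_conv_reachable)
qed

section \<open>Volume, boundary and number of domains\<close>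

text \<open>Across a boundary arc \<open>x\<close> falls from positive to nonpositive, which forces
  \<open>z = 1\<close>, and \<open>s = 1\<close> throughout \<open>D\<close>; so both sides of the
  summed equation reduce to counts.\<close>

lemma (in pair_graph) card_edge_boundary_positive_nodal_domain:
  fixes \<mu> :: real
  assumes eig: "one_laplacian_eigenvector G \<mu> x" and D: "D \<in> positive_nodal_domains G x"
  shows "real (card (edge_boundary G D)) = \<mu> * real (\<Sum>i\<in>D. out_degree (with_proj G) i)"
proof -
  obtain z s where
    "\<forall>(i, j)\<in>parcs G. z i j \<in> Sgn (x i - x j) \<and> z j i = - z i j"
    "\<forall>i\<in>pverts G. s i \<in> Sgn (x i) \<and>
       (\<Sum>j | (i, j) \<in> parcs G. z i j) = \<mu> * real (out_degree (with_proj G) i) * s i"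
    by (rule one_laplacian_eigenvectorE[OF eig])
  then have z: "\<And>i j. (i, j) \<in> parcs G \<Longrightarrow> z i j \<in> Sgn (x i - x j)"
    "\<And>i j. (i, j) \<in> parcs G \<Longrightarrow> z j i = - z i j"
    and s: "\<And>i. i \<in> pverts G \<Longrightarrow> s i \<in> Sgn (x i)"
    "\<And>i. i \<in> pverts G \<Longrightarrow>
       (\<Sum>j | (i, j) \<in> parcs G. z i j) = \<mu> * real (out_degree (with_proj G) i) * s i"
    by blast+
  have sub: "i \<in> pverts G" "x i > 0" if "i \<in> D" for i
    using positive_nodal_domain_subset[OF D] that by auto
  have "z i j = 1" if "(i, j) \<in> edge_boundary G D" for i j
  proof -
    have "(i, j) \<in> parcs G" "i \<in> D" "\<not> x j > 0"
      using that positive_nodal_domain_closed[OF D] by (auto simp: edge_boundary_def)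
    then show ?thesis using z(1)[of i j] sub(2)[of i] by (auto simp: Sgn_def)
  qed
  then have "real (card (edge_boundary G D)) = (\<Sum>(i, j)\<in>edge_boundary G D. z i j)"
    by (simp add: sum.cong[of _ _ "\<lambda>(i, j). z i j" "\<lambda>_. 1"] case_prod_unfold)
  also have "\<dots> = (\<Sum>i\<in>D. \<Sum>j | (i, j) \<in> parcs G. z i j)"
    using sub by (intro sum_z_eq_edge_boundary[symmetric] z(2)) auto
  also have "\<dots> = (\<Sum>i\<in>D. \<mu> * real (out_degree (with_proj G) i))"
  proof (rule sum.cong)
    fix i assume "i \<in> D"
    then have "s i = 1" using s(1)[of i] sub[of i] by (simp add: Sgn_def)
    then show "(\<Sum>j | (i, j) \<in> parcs G. z i j) = \<mu> * real (out_degree (with_proj G) i)"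
      using s(2)[of i] sub(1)[of i] \<open>i \<in> D\<close> by simp
  qed simp
  finally show ?thesis by (simp add: sum_distrib_left)
qed

text \<open>
  Summing the eigenvalue equation over all vertices gives \<open>\<Sum>i. d i * s i = 0\<close> with
  \<open>s i = 1\<close> on the positive vertices and \<open>s i \<ge> -1\<close> elsewhere.
\<close>

lemma (in pair_graph) volume_positive_le:
  fixes \<mu> :: real
  assumes eig: "one_laplacian_eigenvector G \<mu> x" and "\<mu> \<noteq> 0"
  shows "2 * (\<Sum>i | i \<in> pverts G \<and> x i > 0. out_degree (with_proj G) i)
    \<le> (\<Sum>i\<in>pverts G. out_degree (with_proj G) i)"
proof -
  obtain z s where
    "\<forall>(i, j)\<in>parcs G. z i j \<in> Sgn (x i - x j) \<and> z j i = - z i j"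
    "\<forall>i\<in>pverts G. s i \<in> Sgn (x i) \<and>
       (\<Sum>j | (i, j) \<in> parcs G. z i j) = \<mu> * real (out_degree (with_proj G) i) * s i"
    by (rule one_laplacian_eigenvectorE[OF eig])
  then have z: "\<And>i j. (i, j) \<in> parcs G \<Longrightarrow> z i j \<in> Sgn (x i - x j)"
    "\<And>i j. (i, j) \<in> parcs G \<Longrightarrow> z j i = - z i j"
    and s: "\<And>i. i \<in> pverts G \<Longrightarrow> s i \<in> Sgn (x i)"
    "\<And>i. i \<in> pverts G \<Longrightarrow>
       (\<Sum>j | (i, j) \<in> parcs G. z i j) = \<mu> * real (out_degree (with_proj G) i) * s i"
    by blast+
  let ?d = "\<lambda>i. real (out_degree (with_proj G) i)"
  have "edge_boundary G (pverts G) = {}"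
    by (auto simp: edge_boundary_def dest: in_arcsD2)
  then have "(\<Sum>i\<in>pverts G. \<Sum>j | (i, j) \<in> parcs G. z i j) = 0"
    by (simp only: sum_z_eq_edge_boundary[OF order_refl z(2)] sum.empty)
  moreover have "(\<Sum>i\<in>pverts G. \<Sum>j | (i, j) \<in> parcs G. z i j) = (\<Sum>i\<in>pverts G. \<mu> * (?d i * s i))"
    by (intro sum.cong refl) (simp only: s(2) mult.assoc)
  ultimately have "\<mu> * (\<Sum>i\<in>pverts G. ?d i * s i) = 0"
    by (simp only: sum_distrib_left)
  then have "(\<Sum>i\<in>pverts G. ?d i * s i) = 0"
    using \<open>\<mu> \<noteq> 0\<close> by simp
  \<comment> \<open>The left summand is \<open>?d i\<close> at a positive vertex and
    \<open>- ?d i\<close> elsewhere, the least value that \<open>Sgn\<close> permits for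
    \<open>?d i * s i\<close>.\<close>
  moreover have "(\<Sum>i\<in>pverts G. 2 * (if x i > 0 then ?d i else 0) - ?d i)
      \<le> (\<Sum>i\<in>pverts G. ?d i * s i)"
  proof (rule sum_mono)
    fix i assume "i \<in> pverts G"
    then have s_i: "s i \<in> Sgn (x i)" by (rule s(1))
    show "2 * (if x i > 0 then ?d i else 0) - ?d i \<le> ?d i * s i"
    proof (cases "x i > 0")
      case True
      then show ?thesis using s_i by (simp add: Sgn_def)
    next
      case False
      then have "-1 \<le> s i" using s_i by (simp add: Sgn_def split: if_splits)
      then show ?thesis using False mult_left_mono[of "-1" "s i" "?d i"] by simp
    qed
  qed
  ultimately have "2 * (\<Sum>i\<in>pverts G. if x i > 0 then ?d i else 0) \<le> (\<Sum>i\<in>pverts G. ?d i)"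
    unfolding sum_subtractf sum_distrib_left[symmetric] by linarith
  also have "(\<Sum>i\<in>pverts G. if x i > 0 then ?d i else 0) = (\<Sum>i | i \<in> pverts G \<and> x i > 0. ?d i)"
    using pair_finite_verts by (simp add: sum.inter_filter)
  finally have "real (2 * (\<Sum>i | i \<in> pverts G \<and> x i > 0. out_degree (with_proj G) i))
      \<le> real (\<Sum>i\<in>pverts G. out_degree (with_proj G) i)"
    by simp
  then show ?thesis by (simp only: of_nat_le_iff)
qed

text \<open>The boundary identity is summed over the disjoint domains; their union lies in the
  positive vertices, which carry at most half of the volume. Any isoperimetric bound can serve as
  \<open>c\<close>.\<close>

lemma (in pair_graph) card_positive_nodal_domains_le:
  fixes \<mu> :: real
  assumes eig: "one_laplacian_eigenvector G \<mu> x" and "\<mu> > 0"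
    and bdry: "\<And>D. D \<in> positive_nodal_domains G x \<Longrightarrow> c \<le> card (edge_boundary G D)"
  shows "2 * real (c * card (positive_nodal_domains G x))
    \<le> \<mu> * real (\<Sum>i\<in>pverts G. out_degree (with_proj G) i)"
proof -
  let ?P = "positive_nodal_domains G x" and ?d = "out_degree (with_proj G)"
  let ?X = "{i \<in> pverts G. x i > 0}"
  have finX: "finite ?X" using pair_finite_verts by simp
  have sub: "\<Union>?P \<subseteq> ?X"
    using positive_nodal_domain_subset(2) by blast
  have "real (c * card ?P) = (\<Sum>D\<in>?P. real c)"
    by simp
  also have "\<dots> \<le> (\<Sum>D\<in>?P. \<mu> * real (\<Sum>i\<in>D. ?d i))"
    using bdry card_edge_boundary_positive_nodal_domain[OF eig]
    by (intro sum_mono) (metis of_nat_mono)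
  also have "\<dots> = \<mu> * real (\<Sum>D\<in>?P. \<Sum>i\<in>D. ?d i)"
    by (simp add: sum_distrib_left)
  also have "(\<Sum>D\<in>?P. \<Sum>i\<in>D. ?d i) = (\<Sum>i\<in>\<Union>?P. ?d i)"
    using finite_subset[OF positive_nodal_domain_subset(2) finX] positive_nodal_domains_disjoint
    by (subst sum.Union_disjoint) auto
  also have "\<mu> * real \<dots> \<le> \<mu> * real (\<Sum>i\<in>?X. ?d i)"
    using \<open>\<mu> > 0\<close> sub finX
    by (intro mult_left_mono of_nat_mono sum_mono2) auto
  finally have "2 * real (c * card ?P) \<le> \<mu> * real (2 * (\<Sum>i\<in>?X. ?d i))"
    by simp
  also have "\<dots> \<le> \<mu> * real (\<Sum>i\<in>pverts G. ?d i)"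
    using volume_positive_le[OF eig] \<open>\<mu> > 0\<close> by (intro mult_left_mono of_nat_mono) auto
  finally show ?thesis .
qed

text \<open>A label constant along arcs between positive vertices is constant on each domain, so
  distinct labels belong to distinct domains. Counting labels avoids computing the
  components.\<close>

lemma (in pair_graph) card_positive_nodal_domains_ge:
  assumes lab: "\<And>i j. (i, j) \<in> parcs G \<Longrightarrow> x i > 0 \<Longrightarrow> x j > 0 \<Longrightarrow> f i = f j"
  shows "card (f ` {i \<in> pverts G. x i > 0}) \<le> card (positive_nodal_domains G x)"
proof -
  let ?X = "{i \<in> pverts G. x i > 0}"
  let ?H = "with_proj G \<restriction> ?X"
  interpret H: wf_digraph ?H
    by (rule wellformed_induce_subgraph)
  have const: "f u = f v" if "u \<rightarrow>\<^sup>*\<^bsub>?H\<^esub> v" for u v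
    using that by (induction rule: H.converse_reachable_induct) (auto simp: lab arcs_ends_conv)
  \<comment> \<open>Any representative of a domain recovers its label, so the choice made by
    \<open>SOME\<close> does not matter.\<close>
  have "f ` ?X \<subseteq> (\<lambda>D. f (SOME i. i \<in> D)) ` positive_nodal_domains G x"
  proof
    fix l assume "l \<in> f ` ?X"
    then obtain u where u: "u \<in> ?X" "l = f u" by auto
    have "u \<in> H.scc_of u" using u(1) by (intro H.in_scc_of_self) simp
    then have "(SOME i. i \<in> H.scc_of u) \<in> H.scc_of u"
      by (rule someI)
    then have "l = f (SOME i. i \<in> H.scc_of u)"
      using const u(2) by (auto simp: H.scc_of_def)
    then show "l \<in> (\<lambda>D. f (SOME i. i \<in> D)) ` positive_nodal_domains G x"
      unfolding positive_nodal_domains_conv using u(1) by blast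
  qed
  moreover have "finite (positive_nodal_domains G x)"
    unfolding positive_nodal_domains_conv using pair_finite_verts by simp
  ultimately show ?thesis
    by (meson surj_card_le)
qed

text \<open>Domains are nonempty and of one sign, so no set belongs to both families.\<close>

lemma (in pair_graph) nodal_count_eq:
  "nodal_count G x = card (positive_nodal_domains G x) + card (positive_nodal_domains G (\<lambda>i. - x i))"
proof -
  have "finite (positive_nodal_domains G y)" for y :: "'a \<Rightarrow> real"
    unfolding positive_nodal_domains_conv using pair_finite_verts by simp
  moreover have "D \<notin> positive_nodal_domains G (\<lambda>i. - x i)" if "D \<in> positive_nodal_domains G x" for D
    using positive_nodal_domain_subset[OF that]
      positive_nodal_domain_subset(2)[of D "\<lambda>i. - x i"] by force
  ultimately show ?thesis
    unfolding nodal_count_def negative_nodal_domains_eq by (intro card_Un_disjoint) auto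
qed


section \<open>The cycle graph\<close>

lemma parcs_cycle_graph_iff:
  "(i, j) \<in> parcs (cycle_graph n) \<longleftrightarrow>
    i \<in> {1..n} \<and> j \<in> {1..n} \<and> (j = i mod n + 1 \<or> i = j mod n + 1)"
  by (simp add: cycle_graph_def)

lemma pverts_cycle_graph [simp]: "pverts (cycle_graph n) = {1..n}"
  by (simp add: cycle_graph_def)

lemma cycle_succ_eq: "i \<in> {1..n} \<Longrightarrow> i mod n + 1 = (if i = n then 1 else i + 1)" for i n :: nat
  by simp

lemma cycle_graph_neighbours:
  assumes "n \<ge> 3" "i \<in> {1..n}"
  shows "{j. (i, j) \<in> parcs (cycle_graph n)} = {i mod n + 1, if i = 1 then n else i - 1}"
    and "i mod n + 1 \<noteq> (if i = 1 then n else i - 1)"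
proof -
  have "(i, j) \<in> parcs (cycle_graph n) \<longleftrightarrow> j \<in> {i mod n + 1, if i = 1 then n else i - 1}" for j
    using assms cycle_succ_eq[of i n] cycle_succ_eq[of j n]
    unfolding parcs_cycle_graph_iff by (cases "j \<in> {1..n}") (auto split: if_splits)
  then show "{j. (i, j) \<in> parcs (cycle_graph n)} = {i mod n + 1, if i = 1 then n else i - 1}"
    by blast
  show "i mod n + 1 \<noteq> (if i = 1 then n else i - 1)"
    using assms cycle_succ_eq[of i n] by auto
qed

lemma out_degree_cycle_graph:
  assumes "n \<ge> 3" "i \<in> {1..n}"
  shows "out_degree (with_proj (cycle_graph n)) i = 2"
proof -
  have "out_arcs (with_proj (cycle_graph n)) i = Pair i ` {j. (i, j) \<in> parcs (cycle_graph n)}"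
    by (auto simp: out_arcs_def)
  then show ?thesis
    using cycle_graph_neighbours[OF assms]
    by (simp add: out_degree_def card_image inj_on_def)
qed

text \<open>A nonempty set closed under the successor climbs to \<open>n\<close>, wraps round to
  \<open>1\<close>, and is then the whole cycle.\<close>

lemma cycle_succ_exit:
  fixes D :: "nat set"
  assumes "D \<subseteq> {1..n}" "D \<noteq> {}" "D \<noteq> {1..n}"
  obtains i where "i \<in> D" "i mod n + 1 \<notin> D"
proof (rule ccontr)
  assume "\<not> thesis"
  with that have closed: "i mod n + 1 \<in> D" if "i \<in> D" for i
    using \<open>i \<in> D\<close> by blast
  have up: "b \<in> D" if "a \<in> D" "a \<le> b" "b \<le> n" for a b :: nat
    using that(2,1,3)
  proof (induction b rule: dec_induct)
    case (step b)
    then show ?case using closed[of b] by simp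
  qed
  obtain a where "a \<in> D" using assms(2) by blast
  then have "n \<in> D" using up[of a n] assms(1) by auto
  then have "1 \<in> D" using closed[of n] by simp
  then have "{1..n} \<subseteq> D" using up[of 1] by auto
  with assms show False by blast
qed

text \<open>Leaving \<open>D\<close> and leaving its complement each give an arc along the
  orientation; the second one, reversed, also leaves \<open>D\<close>.\<close>

lemma card_edge_boundary_cycle_graph:
  assumes "n \<ge> 3" "D \<subseteq> {1..n}" "D \<noteq> {}" "D \<noteq> {1..n}"
  shows "2 \<le> card (edge_boundary (cycle_graph n) D)"
proof -
  interpret pair_graph "cycle_graph n" using assms(1) by (rule pair_graph_cycle_graph)
  obtain i where i: "i \<in> D" "i mod n + 1 \<notin> D"
    using cycle_succ_exit[OF assms(2-4)] .
  obtain j where j: "j \<in> {1..n} - D" "j mod n + 1 \<notin> {1..n} - D"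
    using cycle_succ_exit[of "{1..n} - D" n] assms by blast
  have ij: "i \<in> {1..n}" "j \<in> {1..n}" using i j assms by auto
  have sub: "{(i, i mod n + 1), (j mod n + 1, j)} \<subseteq> edge_boundary (cycle_graph n) D"
    using i j ij cycle_succ_eq[of i n] cycle_succ_eq[of j n] assms(1)
    by (auto simp: edge_boundary_def parcs_cycle_graph_iff split: if_splits)
  \<comment> \<open>If the two arcs coincided, two successor steps would return to \<open>i\<close>,
    which is impossible for \<open>n \<ge> 3\<close>.\<close>
  have "\<not> (i = j mod n + 1 \<and> i mod n + 1 = j)"
    using ij cycle_succ_eq[of i n] cycle_succ_eq[of j n] assms(1) by (auto split: if_splits)
  then have "2 = card {(i, i mod n + 1), (j mod n + 1, j)}"
    by simp
  also have "\<dots> \<le> card (edge_boundary (cycle_graph n) D)"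
  proof (intro card_mono sub)
    show "finite (edge_boundary (cycle_graph n) D)"
      by (rule finite_subset[OF _ pair_finite_arcs]) (auto simp: edge_boundary_def)
  qed
  finally show ?thesis .
qed

section \<open>Upper bound for the cycle\<close>

lemma card_positive_nodal_domains_cycle_graph_le:
  assumes "n \<ge> 3" "1 \<le> r" "one_laplacian_eigenvector (cycle_graph n) (1 / real r) x"
  shows "card (positive_nodal_domains (cycle_graph n) x) \<le> n div (2 * r)"
proof -
  interpret pair_graph "cycle_graph n" using assms(1) by (rule pair_graph_cycle_graph)
  let ?P = "positive_nodal_domains (cycle_graph n) x"
  have deg: "(\<Sum>i\<in>D. out_degree (with_proj (cycle_graph n)) i) = 2 * card D" if "D \<subseteq> {1..n}" for D
    using out_degree_cycle_graph[OF assms(1)] that by (simp add: subset_iff)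
  have "2 \<le> card (edge_boundary (cycle_graph n) D)" if "D \<in> ?P" for D
  proof (rule card_edge_boundary_cycle_graph[OF assms(1)])
    show sub: "D \<subseteq> {1..n}" "D \<noteq> {}"
      using positive_nodal_domain_subset[OF that] by auto
    show "D \<noteq> {1..n}"
    proof
      \<comment> \<open>The whole cycle has empty boundary, so the boundary identity would give
        \<open>0 = 2 * n / r\<close>.\<close>
      assume "D = {1..n}"
      then have "edge_boundary (cycle_graph n) D = {}"
        by (auto simp: edge_boundary_def parcs_cycle_graph_iff)
      then show False
        using card_edge_boundary_positive_nodal_domain[OF assms(3) that]
        unfolding deg[OF sub(1)] using \<open>D = {1..n}\<close> assms(1,2) by simp
    qed
  qed
  then have "2 * real (2 * card ?P) \<le> 1 / real r * real (2 * n)"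
    using card_positive_nodal_domains_le[OF assms(3), of 2] assms(2)
    unfolding pverts_cycle_graph deg[OF order_refl] by simp
  then have "real (2 * r * card ?P) \<le> real n"
    using assms(2) by (simp add: field_simps)
  then have "card ?P * (2 * r) \<le> n"
    by (simp only: of_nat_le_iff mult.commute)
  then show ?thesis
    using assms(2) by (simp add: less_eq_div_iff_mult_less_eq)
qed

lemma nodal_count_cycle_graph_le:
  assumes "n \<ge> 3" "1 \<le> r" "one_laplacian_eigenvector (cycle_graph n) (1 / real r) x"
  shows "nodal_count (cycle_graph n) x \<le> 2 * (n div (2 * r))"
  using card_positive_nodal_domains_cycle_graph_le[OF assms]
    card_positive_nodal_domains_cycle_graph_le[OF assms(1,2) one_laplacian_eigenvector_uminus[OF assms(3)]]
  by (simp add: pair_graph.nodal_count_eq[OF pair_graph_cycle_graph[OF assms(1)]])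

section \<open>Eigenvectors attaining the bound\<close>

text \<open>\<open>u i\<close> is the value of \<open>z\<close> on the arc from \<open>i\<close> to its successor; index \<open>0\<close> stands for \<open>n\<close>.\<close>

lemma one_laplacian_eigenvector_cycle_graphI:
  assumes n: "n \<ge> 3" and "i\<^sub>0 \<in> {1..n}" "x i\<^sub>0 \<noteq> 0" and wrap: "u 0 = u n"
    and edge: "\<And>i. i \<in> {1..n} \<Longrightarrow> u i \<in> Sgn (x i - x (i mod n + 1))"
    and vertex: "\<And>i. i \<in> {1..n} \<Longrightarrow> u i - u (i - 1) \<in> (\<lambda>s. 2 * \<mu> * s) ` Sgn (x i)"
  shows "one_laplacian_eigenvector (cycle_graph n) \<mu> x"
proof -
  define z where "z i j = (if j = i mod n + 1 then u i else - u j)" for i j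
  \<comment> \<open>No two vertices are each other's successor, so the branches of \<open>z\<close>
    exclude each other on arcs and \<open>z\<close> is antisymmetric.\<close>
  have nocyc: "\<not> (j = i mod n + 1 \<and> i = j mod n + 1)" if "i \<in> {1..n}" "j \<in> {1..n}" for i j
    using that cycle_succ_eq[of i n] cycle_succ_eq[of j n] n by (auto split: if_splits)
  have "z i j \<in> Sgn (x i - x j) \<and> z j i = - z i j" if "(i, j) \<in> parcs (cycle_graph n)" for i j
  proof -
    from that have ij: "i \<in> {1..n}" "j \<in> {1..n}" and "j = i mod n + 1 \<or> i = j mod n + 1"
      by (auto simp: parcs_cycle_graph_iff)
    then consider "j = i mod n + 1" "i \<noteq> j mod n + 1" | "j \<noteq> i mod n + 1" "i = j mod n + 1"
      using nocyc by blast
    then show ?thesis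
    proof cases
      case 1
      then show ?thesis using edge[OF ij(1)] by (simp add: z_def)
    next
      case 2
      then show ?thesis using edge[OF ij(2)] Sgn_uminus[of "x j - x i"] by (simp add: z_def)
    qed
  qed
  moreover have "(\<Sum>j | (i, j) \<in> parcs (cycle_graph n). z i j)
      \<in> (\<lambda>s. \<mu> * real (out_degree (with_proj (cycle_graph n)) i) * s) ` Sgn (x i)"
    if "i \<in> {1..n}" for i
  proof -
    let ?p = "if i = 1 then n else i - 1"
    have "(\<Sum>j | (i, j) \<in> parcs (cycle_graph n). z i j) = z i (i mod n + 1) + z i ?p"
      unfolding cycle_graph_neighbours(1)[OF n that]
      using cycle_graph_neighbours(2)[OF n that] by simp
    \<comment> \<open>The predecessor contributes \<open>- u ?p\<close>; for \<open>i = 1\<close> it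
      is \<open>n\<close>, and \<open>wrap\<close> replaces \<open>u n\<close> by
      \<open>u 0\<close>.\<close>
    also have "\<dots> = u i - u (i - 1)"
      using cycle_graph_neighbours(2)[OF n that] wrap by (auto simp: z_def)
    finally show ?thesis
      using vertex[OF that] out_degree_cycle_graph[OF n that] by (simp add: mult.commute)
  qed
  ultimately show ?thesis
    using assms(2,3) unfolding one_laplacian_eigenvector_def pverts_cycle_graph by blast
qed

text \<open>Alternating blocks of \<open>r\<close> ones and \<open>r\<close> minus ones, padded with fewer than \<open>2 * r\<close> zeros.\<close>

definition block_vector :: "nat \<Rightarrow> nat \<Rightarrow> nat \<Rightarrow> real" where
  "block_vector n r i =
    (if 2 * r * (n div (2 * r)) < i then 0 else if (i - 1) mod (2 * r) < r then 1 else -1)"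

text \<open>The tent \<open>h\<close> climbs from \<open>-1\<close> at \<open>0\<close> to
  \<open>1\<close> at \<open>r\<close> and returns to \<open>-1\<close> at \<open>2 * r\<close>; its
  slopes \<open>2 / r\<close> and \<open>- 2 / r\<close> are what the vertex equation demands on the
  two blocks. \<open>u\<close> repeats the tent on every period and rests at \<open>-1\<close> on
  the padding, where the selection \<open>0\<close> solves the equation.\<close>

lemma block_vector_eigenvector:
  assumes n: "n \<ge> 3" and r: "1 \<le> r" "r \<le> n div 2"
  shows "one_laplacian_eigenvector (cycle_graph n) (1 / real r) (block_vector n r)"
proof -
  define L where "L = 2 * r * (n div (2 * r))"
  define h where "h m = 1 - 2 * \<bar>real m - real r\<bar> / real r" for m
  define u where "u i = (if i \<le> L then h (i mod (2 * r)) else -1)" for i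
  let ?x = "block_vector n r"
  have x: "?x i = (if L < i then 0 else if (i - 1) mod (2 * r) < r then 1 else -1)" for i
    by (simp add: block_vector_def L_def)
  have "2 * r \<le> n" using r by simp
  then have "1 \<le> n div (2 * r)" using r by (simp add: less_eq_div_iff_mult_less_eq)
  then have L: "L \<le> n" "L mod (2 * r) = 0" "2 * r \<le> L"
    by (simp_all add: L_def)
  have h0: "h 0 = -1" using r by (simp add: h_def)
  have hr: "h r = 1" by (simp add: h_def)
  have h_abs: "h m \<in> {-1..1}" if "m \<le> 2 * r" for m
    using that r by (auto simp: h_def field_simps)
  have u_abs: "u i \<in> {-1..1}" for i
    using h_abs[of "i mod (2 * r)"] r by (auto simp: u_def less_imp_le)
  have uL: "u i = -1" if "L \<le> i" for i
    using that L h0 by (cases "i = L") (auto simp: u_def)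
  show ?thesis
  proof (rule one_laplacian_eigenvector_cycle_graphI[OF n])
    show "1 \<in> {1..n}" using n by simp
    show "?x 1 \<noteq> 0" using L r by (simp add: x)
    show "u 0 = u n" using uL[OF L(1)] h0 by (simp add: u_def)
  next
    fix i assume i: "i \<in> {1..n}"
    define p where "p = i - 1"
    then have p: "i = Suc p" using i by simp
    show "u i - u (i - 1) \<in> (\<lambda>s. 2 * (1 / real r) * s) ` Sgn (?x i)"
    proof (cases "L < i")
      case True
      then show ?thesis using uL[of i] uL[of "i - 1"] by (auto simp: x Sgn_def)
    next
      case False
      let ?m = "p mod (2 * r)"
      have m: "?m < 2 * r" using r by simp
      \<comment> \<open>At the end of a period \<open>Suc ?m\<close> is \<open>2 * r\<close> while
        \<open>i mod (2 * r)\<close> is \<open>0\<close>; \<open>h\<close> is \<open>-1\<close> at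
        both.\<close>
      have "u i = h (Suc ?m)"
        using False h0 r by (auto simp: u_def p mod_Suc h_def)
      then have "u i - u (i - 1) = h (Suc ?m) - h ?m"
        using False by (simp add: u_def p)
      also have "\<dots> = 2 * (1 / real r) * ?x i"
        using False r m by (auto simp: x p h_def field_simps)
      finally show ?thesis using False by (auto simp: x Sgn_def)
    qed
    show "u i \<in> Sgn (?x i - ?x (i mod n + 1))"
    proof (cases "i < L")
      case True
      then have s: "i mod n + 1 = Suc i" using L(1) by simp
      then have *: "?x i = (if p mod (2 * r) < r then 1 else -1)"
          "?x (i mod n + 1) = (if Suc p mod (2 * r) < r then 1 else -1)" "u i = h (Suc p mod (2 * r))"
        using True by (simp_all add: x p u_def del: mod_Suc)
      \<comment> \<open>The second case passes from a negative block to a positive one, with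
        \<open>u i = -1\<close>; the third from positive to negative, with \<open>u i = 1\<close>.
        The other two stay inside a block, where any value in \<open>{-1..1}\<close> is
        allowed.\<close>
      consider "p mod (2 * r) < r" "Suc p mod (2 * r) < r" | "\<not> p mod (2 * r) < r" "Suc p mod (2 * r) = 0"
        | "p mod (2 * r) < r" "Suc p mod (2 * r) = r" | "\<not> p mod (2 * r) < r" "\<not> Suc p mod (2 * r) < r"
        using r by (cases "p mod (2 * r) < r"; cases "Suc p mod (2 * r) < r")
          (auto simp: mod_Suc split: if_splits)
      then show ?thesis
        using u_abs[of i] h0 hr r unfolding * by cases (simp_all add: Sgn_def)
    next
      case False
      \<comment> \<open>From \<open>L\<close> on, the successor carries \<open>0\<close>, or
        \<open>1\<close> after wrapping to the first vertex. The difference of values is never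
        positive, so \<open>u i = -1\<close> is admissible.\<close>
      have "?x (i mod n + 1) \<in> {0, 1}"
        using False L r i cycle_succ_eq[OF i] by (auto simp: x)
      moreover have "?x i \<in> {-1, 0}"
      proof (cases "i = L")
        case True
        then have "Suc p mod (2 * r) = 0" using L p by simp
        then have "Suc (p mod (2 * r)) = 2 * r" by (simp add: mod_Suc split: if_splits)
        then have "\<not> p mod (2 * r) < r" using r by simp
        then show ?thesis by (simp add: x p True[symmetric])
      qed (use False in \<open>auto simp: x\<close>)
      ultimately show ?thesis using uL[of i] False by (auto simp: Sgn_def)
    qed
  qed
qed

text \<open>\<open>?f\<close> numbers the periods. Each of the \<open>k\<close> full periods meets
  both signs, and adjacent vertices with equal nonzero values lie in the same period, so each sign
  has at least \<open>k\<close> domains.\<close>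

lemma nodal_count_block_vector_ge:
  assumes n: "n \<ge> 3" and r: "1 \<le> r" "r \<le> n div 2"
  shows "2 * (n div (2 * r)) \<le> nodal_count (cycle_graph n) (block_vector n r)"
proof -
  interpret pair_graph "cycle_graph n" using n by (rule pair_graph_cycle_graph)
  define k where "k = n div (2 * r)"
  define L where "L = 2 * r * k"
  let ?x = "block_vector n r" and ?f = "\<lambda>i. (i - 1) div (2 * r)"
  have x: "?x i = (if L < i then 0 else if (i - 1) mod (2 * r) < r then 1 else -1)" for i
    by (simp add: block_vector_def L_def k_def)
  have "2 * r \<le> n" using r by simp
  then have "1 \<le> k" using r by (simp add: k_def less_eq_div_iff_mult_less_eq)
  then have L: "L \<le> n" "L mod (2 * r) = 0" "1 \<le> L"
    using r by (simp_all add: L_def k_def)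
  \<comment> \<open>Vertices \<open>1\<close> and \<open>n\<close> are adjacent but may lie in
    different periods, so their values must be shown to differ.\<close>
  have x1: "?x 1 = 1"
    using r L by (simp add: x)
  have xn: "?x n \<noteq> 1"
  proof (cases "L = n")
    case True
    then have "Suc (n - 1) mod (2 * r) = 0" using n L(2) by simp
    then have "Suc ((n - 1) mod (2 * r)) = 2 * r" by (simp only: mod_Suc split: if_splits)
    then show ?thesis using r by (simp add: x)
  qed (use L in \<open>simp add: x\<close>)
  \<comment> \<open>The label increases only where the residue goes from \<open>2 * r - 1\<close> to
    \<open>0\<close>; nonzero values there would be \<open>-1\<close> and then
    \<open>1\<close>.\<close>
  have step: "?f a = ?f (Suc a)" if "1 \<le> a" and eq: "?x a = ?x (Suc a)" "?x a \<noteq> 0" for a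
  proof -
    obtain p where p: "a = Suc p" using \<open>1 \<le> a\<close> by (cases a) auto
    have "p mod (2 * r) < r \<longleftrightarrow> Suc p mod (2 * r) < r"
      using eq unfolding x p by (simp split: if_splits)
    moreover have "Suc p mod (2 * r) = 0" if "Suc (p mod (2 * r)) = 2 * r"
      using that by (simp only: mod_Suc if_True refl)
    ultimately have "Suc (p mod (2 * r)) \<noteq> 2 * r"
      using r by auto
    then have "Suc p mod (2 * r) \<noteq> 0" by (simp only: mod_Suc if_False)
    then have "Suc p div (2 * r) = p div (2 * r)" by (simp only: div_Suc if_False)
    then show ?thesis by (simp only: p diff_Suc_1)
  qed
  have lab: "?f i = ?f j"
    if arc: "(i, j) \<in> parcs (cycle_graph n)" and eq: "?x i = ?x j" and nz: "?x i \<noteq> 0" for i j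
  proof -
    from arc have ij: "i \<in> {1..n}" "j \<in> {1..n}" and "j = i mod n + 1 \<or> i = j mod n + 1"
      by (auto simp: parcs_cycle_graph_iff)
    then consider "j = Suc i" | "i = Suc j" | "i = n" "j = 1" | "i = 1" "j = n"
      using cycle_succ_eq[of i n] cycle_succ_eq[of j n] by (auto split: if_splits)
    then show ?thesis
      using step[of i] step[of j] ij eq nz x1 xn by cases auto
  qed
  have idx: "2 * r * l + m < L" if "l < k" "m < 2 * r" for l m
  proof -
    have "2 * r * l + m < 2 * r * Suc l" using that by simp
    also have "\<dots> \<le> L" unfolding L_def using that by (intro mult_le_mono2) simp
    finally show ?thesis .
  qed
  have "{..<k} \<subseteq> ?f ` {i \<in> pverts (cycle_graph n). ?x i > 0}"
  proof
    fix l assume "l \<in> {..<k}"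
    \<comment> \<open>The witness is the first vertex of the positive block in period
      \<open>l\<close>.\<close>
    then show "l \<in> ?f ` {i \<in> pverts (cycle_graph n). ?x i > 0}"
      using idx[of l 0] L(1) r
      by (intro image_eqI[of _ _ "2 * r * l + 1"]) (auto simp: x)
  qed
  then have "k \<le> card (?f ` {i \<in> pverts (cycle_graph n). ?x i > 0})"
    using card_mono[of "?f ` {i \<in> pverts (cycle_graph n). ?x i > 0}" "{..<k}"] by simp
  also have "\<dots> \<le> card (positive_nodal_domains (cycle_graph n) ?x)"
    by (rule card_positive_nodal_domains_ge, rule lab) (auto simp: x split: if_splits)
  finally have P: "k \<le> card (positive_nodal_domains (cycle_graph n) ?x)" .
  have "{..<k} \<subseteq> ?f ` {i \<in> pverts (cycle_graph n). - ?x i > 0}"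
  proof
    fix l assume "l \<in> {..<k}"
    \<comment> \<open>Shifting by \<open>r\<close> gives the first vertex of the negative
      block.\<close>
    then show "l \<in> ?f ` {i \<in> pverts (cycle_graph n). - ?x i > 0}"
      using idx[of l r] L(1) r
      by (intro image_eqI[of _ _ "2 * r * l + r + 1"]) (auto simp: x)
  qed
  then have "k \<le> card (?f ` {i \<in> pverts (cycle_graph n). - ?x i > 0})"
    using card_mono[of "?f ` {i \<in> pverts (cycle_graph n). - ?x i > 0}" "{..<k}"] by simp
  also have "\<dots> \<le> card (positive_nodal_domains (cycle_graph n) (\<lambda>i. - ?x i))"
    by (rule card_positive_nodal_domains_ge, rule lab) (auto simp: x split: if_splits)
  finally show ?thesis using P by (simp add: nodal_count_eq k_def)
qed

theorem theorem4:
  fixes n r :: nat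
  assumes "n \<ge> 3" and "1 \<le> r" and "r \<le> n div 2"
  shows "max_nodal_count (1 / real r) (cycle_graph n) = 2 * (n div (2 * r)) \<and>
    (\<exists>\<phi>. one_laplacian_eigenvector (cycle_graph n) (1 / real r) \<phi> \<and>
         nodal_count (cycle_graph n) \<phi> = max_nodal_count (1 / real r) (cycle_graph n))"
proof -
  let ?S = "{nodal_count (cycle_graph n) \<phi> | \<phi>.
    one_laplacian_eigenvector (cycle_graph n) (1 / real r) \<phi>}"
  have eig: "one_laplacian_eigenvector (cycle_graph n) (1 / real r) (block_vector n r)"
    using assms by (rule block_vector_eigenvector)
  have count: "nodal_count (cycle_graph n) (block_vector n r) = 2 * (n div (2 * r))"
    using nodal_count_cycle_graph_le[OF assms(1,2) eig] nodal_count_block_vector_ge[OF assms]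
    by simp
  have le: "m \<le> 2 * (n div (2 * r))" if "m \<in> ?S" for m
    using that nodal_count_cycle_graph_le[OF assms(1,2)] by auto
  \<comment> \<open>The uniform bound also makes the set finite, as is needed to evaluate
    \<open>Max\<close>.\<close>
  then have "finite ?S"
    using finite_nat_set_iff_bounded_le by blast
  then have "max_nodal_count (1 / real r) (cycle_graph n) = 2 * (n div (2 * r))"
    unfolding max_nodal_count_def using le eig count
    by (intro Max_eqI CollectI exI[of _ "block_vector n r"] conjI) simp_all
  with eig count show ?thesis by metis
qed

end
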